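(* There exists a weak $q$-$g$-matroid that is not a $q$-$g$-matroid. That is, there exist a finite field $\mathbb{F}_q$, an integer $n$, and a family $\mathcal{F}$ of subspaces of $E=\mathbb{F}_q^n$ such that $(E,\mathcal{F})$ is a weak $q$-$g$-matroid but not a $q$-$g$-matroid.
   Context: Let $E$ be a finite-dimensional vector space over a field. A $q$-matroid on $E$ is a pair $M=(E,r)$ with $r$ an integer-valued function on the subspaces of $E$ such that (R1) $0\le r(A)\le\dim A$ for every subspace $A$; (R2) $r(A)\le r(B)$ whenever $A\subseteq B$; (R3) $r(A+B)+r(A\cap B)\le r(A)+r(B)$ for all subspaces $A,B$. A subspace $A$ is independent if $r(A)=\dim A$; a basis is an inclusion-maximal independent subspace; $A$ is spanning if $r(A)=r(E)$; $A$ is a flat if $r(A+x)>r(A)$ for every $1$-dimensional subspace $x\not\subseteq A$. For $q$-matroids $M_1,M_2$ on the same ground space $E$, the identity $Id:M_1\to M_2$ is a strong map if every flat of $M_2$ is a flat of $M_1$. A $q$-$g$-matroid is a pair $(E,\mathcal{F})$ for which there exist $q$-matroids $M_1,M_2$ on $E$ such that $Id:M_1\to M_2$ is a strong map and $\mathcal{F}$ is the set of all subspaces of $E$ that are independent in $M_1$ and spanning in $M_2$. A weak $q$-$g$-matroid is a pair $(E,\mathcal{F})$ for which there exist $q$-matroids $M_1,M_2$ on $E$ such that every basis of $M_2$ is contained in a basis of $M_1$, every basis of $M_1$ contains a basis of $M_2$, and $\mathcal{F}$ is the set of all subspaces $F\subseteq E$ for which there exist a basis $B_2$ of $M_2$ and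 a basis $B_1$ of $M_1$ with $B_2\subseteq F\subseteq B_1$. *)

theory Defs
  imports "Jordan_Normal_Form.Missing_VectorSpace"
begin

text \<open>
  The ground space is a \<open>vectorspace K V\<close> in the record-based sense, so that the field and
  the dimension can be quantified over inside a formula. The rank function is a function on all
  sets of vectors, but only its values on subspaces are ever used.
\<close>

locale q_matroid = vectorspace K V for K and V +
  fixes r :: "'c set \<Rightarrow> int"
  assumes finite_dimensional: "fin_dim"
    and rank_bounds: "subspace K A V \<Longrightarrow> 0 \<le> r A \<and> r A \<le> int (vectorspace.dim K (vs A))"
    and rank_mono: "\<lbrakk>subspace K A V; subspace K B V; A \<subseteq> B\<rbrakk> \<Longrightarrow> r A \<le> r B"
    and rank_submodular: "\<lbrakk>subspace K A V; subspace K B V\<rbrakk>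
      \<Longrightarrow> r (subspace_sum A B) + r (A \<inter> B) \<le> r A + r B"
begin

definition q_independent :: "'c set \<Rightarrow> bool" where
  "q_independent A \<longleftrightarrow> subspace K A V \<and> r A = int (vectorspace.dim K (vs A))"

text \<open>Not to be confused with \<open>basis\<close>, which is about sets of vectors.\<close>

definition q_basis :: "'c set \<Rightarrow> bool" where
  "q_basis B \<longleftrightarrow> q_independent B \<and> (\<forall>A. q_independent A \<and> B \<subseteq> A \<longrightarrow> A = B)"

definition q_spanning :: "'c set \<Rightarrow> bool" where
  "q_spanning A \<longleftrightarrow> subspace K A V \<and> r A = r (carrier V)"

definition q_flat :: "'c set \<Rightarrow> bool" where
  "q_flat A \<longleftrightarrow> subspace K A V \<and>
    (\<forall>X. subspace K X V \<and> vectorspace.dim K (vs X) = 1 \<and> \<not> X \<subseteq> A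
      \<longrightarrow> r (subspace_sum A X) > r A)"

end

definition id_strong_map ::
  "('a, 'b) ring_scheme \<Rightarrow> ('a, 'c, 'd) module_scheme \<Rightarrow> ('c set \<Rightarrow> int) \<Rightarrow> ('c set \<Rightarrow> int) \<Rightarrow> bool"
  where "id_strong_map K V r1 r2 \<longleftrightarrow>
    (\<forall>A. q_matroid.q_flat K V r2 A \<longrightarrow> q_matroid.q_flat K V r1 A)"

definition q_g_matroid ::
  "('a, 'b) ring_scheme \<Rightarrow> ('a, 'c, 'd) module_scheme \<Rightarrow> 'c set set \<Rightarrow> bool"
  where "q_g_matroid K V \<F> \<longleftrightarrow>
    (\<exists>r1 r2. q_matroid K V r1 \<and> q_matroid K V r2 \<and> id_strong_map K V r1 r2 \<and>
      \<F> = {F. q_matroid.q_independent K V r1 F \<and> q_matroid.q_spanning K V r2 F})"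

definition weak_q_g_matroid ::
  "('a, 'b) ring_scheme \<Rightarrow> ('a, 'c, 'd) module_scheme \<Rightarrow> 'c set set \<Rightarrow> bool"
  where "weak_q_g_matroid K V \<F> \<longleftrightarrow>
    (\<exists>r1 r2. q_matroid K V r1 \<and> q_matroid K V r2 \<and>
      (\<forall>B2. q_matroid.q_basis K V r2 B2 \<longrightarrow> (\<exists>B1. q_matroid.q_basis K V r1 B1 \<and> B2 \<subseteq> B1)) \<and>
      (\<forall>B1. q_matroid.q_basis K V r1 B1 \<longrightarrow> (\<exists>B2. q_matroid.q_basis K V r2 B2 \<and> B2 \<subseteq> B1)) \<and>
      \<F> = {F. subspace K F V \<and>
        (\<exists>B2 B1. q_matroid.q_basis K V r2 B2 \<and> q_matroid.q_basis K V r1 B1 \<and> B2 \<subseteq> F \<and> F \<subseteq> B1)})"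

text \<open>The space \<open>K\<^sup>n\<close>, realised as the functions from \<open>{..<n}\<close> to \<open>K\<close>.\<close>

abbreviation coordinate_space :: "('a, 'b) ring_scheme \<Rightarrow> nat \<Rightarrow> ('a, nat \<Rightarrow> 'a) module"
  where "coordinate_space K n \<equiv> LinearCombinations.ring.func_space K {..<n}"

end

theory Submission
  imports "HOL-Number_Theory.Residues" "Jordan_Normal_Form.DL_Rank" Defs
begin

text \<open>
  Take a line \<open>C\<close> inside a plane \<open>D\<close> of the ground space \<open>E\<close>. Let the bases of \<open>M\<^sub>1\<close> be the planes other than
  \<open>D\<close> and those of \<open>M\<^sub>2\<close> the lines other than \<open>C\<close>; the weak \<open>q\<close>-\<open>g\<close>-matroid \<open>\<F>\<close> consists of
  exactly these subspaces. If a strong pair \<open>(N\<^sub>1, N\<^sub>2)\<close> gave the same \<open>\<F>\<close>, then \<open>C\<close> would be independent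
  in \<open>N\<^sub>1\<close>, as it lies in a plane of \<open>\<F>\<close>, hence not spanning in \<open>N\<^sub>2\<close>. Since every other line is
  spanning in \<open>N\<^sub>2\<close>, \<open>C\<close> would be a flat of \<open>N\<^sub>2\<close> and so of \<open>N\<^sub>1\<close>. Then \<open>D\<close> would be independent in
  \<open>N\<^sub>1\<close> and spanning in \<open>N\<^sub>2\<close>, which contradicts \<open>D \<notin> \<F>\<close>.
\<close>

section \<open>Dimension of subspaces\<close>

context vectorspace
begin

abbreviation vdim :: "'c set \<Rightarrow> nat" where
  "vdim A \<equiv> vectorspace.dim K (vs A)"

lemma subspace_carrier: "subspace K A V \<Longrightarrow> A \<subseteq> carrier V"
  using is_module submodule.subset by blast

lemma carrier_is_subspace: "subspace K (carrier V) V"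
  by (simp add: subspace_def submodule_def vectorspace_axioms module_axioms)

lemma subspace_Int: "\<lbrakk>subspace K A V; subspace K B V\<rbrakk> \<Longrightarrow> subspace K (A \<inter> B) V"
  by (auto simp: subspace_def submodule_def)

text \<open>Linear independence and span do not depend on whether they are taken in
  \<open>vs A\<close> or in \<open>V\<close>. Independent sets in \<open>A\<close> thus have at most
  \<open>dim\<close> elements, so a maximal one exists and is a finite basis of \<open>A\<close>. If
  it has \<open>dim\<close> elements, it is a basis of \<open>V\<close> too.\<close>

lemma dim_le_imp_whole:
  assumes "fin_dim" "subspace K A V"
  shows "vectorspace.fin_dim K (vs A)" "vdim A \<le> dim" "vdim A = dim \<Longrightarrow> A = carrier V"
proof -
  interpret A: vectorspace K "vs A"
    using assms subspace_is_vs by blast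
  have sub: "submodule K A V" "A \<subseteq> carrier V"
    using assms subspace_carrier by auto
  note transfer = span_li_not_depend[OF _ sub(1)]
  have bound: "finite S \<and> card S \<le> dim" if "S \<subseteq> carrier (vs A) \<and> A.lin_indpt S" for S
    using that transfer(2)[of S] li_le_dim[OF assms(1), of S] sub by auto
  obtain S where "finite S" and "maximal S (\<lambda>S. S \<subseteq> carrier (vs A) \<and> A.lin_indpt S)"
    using maximal_exists[of "\<lambda>S. S \<subseteq> carrier (vs A) \<and> A.lin_indpt S" dim "{}"] bound
    by (auto simp: A.finite_lin_indpt2)
  then have S: "finite S" "A.basis S"
    using A.max_li_is_basis by auto
  then have SA: "S \<subseteq> A" "A.lin_indpt S" "A.span S = A"
    by (auto simp: A.basis_def)
  show "vectorspace.fin_dim K (vs A)"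
    unfolding A.fin_dim_def using S SA by auto
  have d: "vdim A = card S"
    using A.dim_basis S by auto
  then show "vdim A \<le> dim"
    using bound SA by auto
  assume "vdim A = dim"
  then have "basis S"
    using dim_li_is_basis[OF assms(1) S(1)] SA sub transfer(2)[of S] d by auto
  then show "A = carrier V"
    using SA transfer(1)[of S] by (auto simp: basis_def)
qed

text \<open>This is \<open>dim_le_imp_whole\<close> with \<open>B\<close> as the ambient
  space.\<close>

lemma dim_strict_mono:
  assumes "fin_dim" "subspace K A V" "subspace K B V" "A \<subset> B"
  shows "vdim A < vdim B"
proof -
  interpret B: vectorspace K "vs B"
    using assms subspace_is_vs by blast
  have A: "subspace K A (vs B)"
    using assms nested_subspaces by auto
  have B: "B.fin_dim"
    using assms dim_le_imp_whole by auto
  show ?thesis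
    using B.dim_le_imp_whole(2,3)[OF B A] assms(4) by (simp add: order.strict_iff_order) blast
qed

lemma dim_mono:
  assumes "fin_dim" "subspace K A V" "subspace K B V" "A \<subseteq> B"
  shows "vdim A \<le> vdim B"
  using dim_strict_mono[OF assms(1-3)] assms(4) by (cases "A = B") (simp_all add: psubset_eq)

lemma subset_dim_ge_imp_eq:
  assumes "fin_dim" "subspace K A V" "subspace K B V" "A \<subseteq> B" "vdim B \<le> vdim A"
  shows "A = B"
  using dim_strict_mono[OF assms(1-3)] assms(4,5) by (metis not_le psubsetI)

lemma subspace_span_singleton: "w \<in> carrier V \<Longrightarrow> subspace K (span {w}) V"
  by (simp add: span_is_subspace)

lemma span_singleton_subset: "\<lbrakk>subspace K A V; w \<in> A\<rbrakk> \<Longrightarrow> span {w} \<subseteq> A"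
  by (simp add: span_is_subset)

lemma dim_span_singleton_le:
  assumes "w \<in> carrier V"
  shows "vdim (span {w}) \<le> 1"
proof -
  interpret W: vectorspace K "vs (span {w})"
    using assms subspace_is_vs subspace_span_singleton by blast
  have "W.span {w} = span {w}"
    using assms span_li_not_depend(1)[of "{w}" "span {w}"] subspace_span_singleton span_self by auto
  then show ?thesis
    using W.dim_le1I[of w] assms span_self by auto
qed

lemma subset_subspace_sum:
  assumes "subspace K A V" "subspace K B V"
  shows "A \<subseteq> subspace_sum A B" "B \<subseteq> subspace_sum A B"
  using vsum_is_minimal[OF assms sum_is_subspace[OF assms]] by auto

lemma dim_sum_span_singleton_le:
  assumes "fin_dim" "subspace K A V" "w \<in> carrier V"
  shows "vdim (subspace_sum A (span {w})) \<le> Suc (vdim A)"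
proof -
  note W = subspace_span_singleton[OF assms(3)]
  show ?thesis
    using dim_subadditive[OF assms(2) dim_le_imp_whole(1)[OF assms(1,2)] W
        dim_le_imp_whole(1)[OF assms(1) W]] dim_span_singleton_le[OF assms(3)] by linarith
qed

text \<open>\<open>A \<inter> B\<close> is a proper subspace of \<open>A\<close>, so its dimension
  is strictly smaller.\<close>

lemma dim_pos_if_not_subset:
  assumes "fin_dim" "subspace K A V" "subspace K B V" "\<not> A \<subseteq> B"
  shows "vdim A > 0"
proof -
  have "A \<inter> B \<subset> A"
    using assms(4) by blast
  then show ?thesis
    using dim_strict_mono[OF assms(1) subspace_Int[OF assms(2,3)] assms(2)] by simp
qed

lemma dim_span_singleton:
  assumes "fin_dim" "subspace K B V" "w \<in> carrier V" "w \<notin> B"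
  shows "vdim (span {w}) = 1"
proof -
  have "\<not> span {w} \<subseteq> B"
    using span_self[OF assms(3)] assms(4) by blast
  then show ?thesis
    using dim_pos_if_not_subset[OF assms(1) subspace_span_singleton[OF assms(3)] assms(2)]
      dim_span_singleton_le[OF assms(3)] by linarith
qed

end

section \<open>The two rank functions\<close>

locale point_on_line = vectorspace K V for K and V +
  fixes C D :: "'c set"
  assumes fin: "fin_dim"
    and C: "subspace K C V" "vdim C = 1"
    and D: "subspace K D V" "vdim D = 2"
    and CD: "C \<subseteq> D" and D_proper: "D \<noteq> carrier V"
begin

text \<open>The uniform \<open>q\<close>-matroid of rank 2, with the rank of the single plane
  \<open>D\<close> lowered to 1.\<close>

definition rank1 :: "'c set \<Rightarrow> int" where
  "rank1 A = (if A = D then 1 else int (min 2 (vdim A)))"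

text \<open>Rank one, with \<open>C\<close> as the space of loops.\<close>

definition rank2 :: "'c set \<Rightarrow> int" where
  "rank2 A = (if A \<subseteq> C then 0 else 1)"

text \<open>Lowering the value at \<open>D\<close> could only do harm for proper subspaces of
  \<open>D\<close>, but these have dimension at most 1.\<close>

lemma rank1_mono:
  assumes "subspace K A V" "subspace K B V" "A \<subseteq> B"
  shows "rank1 A \<le> rank1 B"
proof (cases "B = D \<and> A \<noteq> D")
  case True
  then have "vdim A < vdim D"
    using dim_strict_mono[OF fin assms(1) D(1)] assms(3) by blast
  then show ?thesis
    using True D(2) by (simp add: rank1_def)
next
  case False
  then show ?thesis
    using dim_mono[OF fin assms] D by (auto simp: rank1_def)
qed

lemma rank1_submodular:
  assumes A: "subspace K A V" and B: "subspace K B V"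
  shows "rank1 (subspace_sum A B) + rank1 (A \<inter> B) \<le> rank1 A + rank1 B"
proof -
  note I = subspace_Int[OF A B]
  consider "A \<subseteq> B" | "B \<subseteq> A" | "\<not> A \<subseteq> B" "\<not> B \<subseteq> A" by blast
  then show ?thesis
  proof cases
    case 1
    then have "subspace_sum A B = B"
      using vsum_is_minimal[OF A B B] subset_subspace_sum[OF A B] by auto
    then show ?thesis
      using 1 by (simp add: Int_absorb2)
  next
    case 2
    then have "subspace_sum A B = A"
      using vsum_is_minimal[OF A B A] subset_subspace_sum[OF A B] by auto
    then show ?thesis
      using 2 by (simp add: Int_absorb1)
  next
    case 3
    \<comment> \<open>For incomparable \<open>A\<close> and \<open>B\<close> it suffices to bound
      the rank of the sum by 2 and that of the intersection by its dimension and by 2. If, say,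
      \<open>A = D\<close>, the intersection has dimension at most 1, which makes up for the lowered
      rank of \<open>D\<close>.\<close>
    then have "vdim (A \<inter> B) < vdim A" "vdim (A \<inter> B) < vdim B"
      using dim_strict_mono[OF fin I] A B by blast+
    moreover have "rank1 X \<le> int (vdim X)" "rank1 X \<le> 2" for X
      using D(2) by (auto simp: rank1_def)
    note this[of "A \<inter> B"] this(2)[of "subspace_sum A B"]
    moreover have "rank1 X = (if X = D then 1 else int (min 2 (vdim X)))" for X
      by (rule rank1_def)
    note this[of A] this[of B]
    moreover have "A \<noteq> B"
      using 3 by auto
    ultimately show ?thesis
      using D(2) by (cases "A = D"; cases "B = D") simp_all
  qed
qed

lemma q_matroid_rank1: "q_matroid K V rank1"
proof
  show "fin_dim" by (rule fin)
  show "0 \<le> rank1 A \<and> rank1 A \<le> int (vdim A)" for A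
    using D(2) by (auto simp: rank1_def)
qed (fact rank1_mono rank1_submodular)+

lemma q_matroid_rank2: "q_matroid K V rank2"
proof
  show "fin_dim" by (rule fin)
  show "0 \<le> rank2 A \<and> rank2 A \<le> int (vdim A)" if "subspace K A V" for A
    using dim_pos_if_not_subset[OF fin that C(1)] by (cases "A \<subseteq> C") (simp_all add: rank2_def)
  show "rank2 A \<le> rank2 B" if "A \<subseteq> B" for A B
    using that by (auto simp: rank2_def)
  show "rank2 (subspace_sum A B) + rank2 (A \<inter> B) \<le> rank2 A + rank2 B"
    if "subspace K A V" "subspace K B V" for A B
    \<comment> \<open>If the sum is not inside \<open>C\<close>, one of \<open>A\<close>,
      \<open>B\<close> is not; if the intersection is not inside \<open>C\<close>, neither of them
      is.\<close>
    using vsum_is_minimal[OF that C(1)] by (simp add: rank2_def) blast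
qed

sublocale M1: q_matroid K V rank1
  by (rule q_matroid_rank1)

sublocale M2: q_matroid K V rank2
  by (rule q_matroid_rank2)

section \<open>Independent subspaces and bases of the two matroids\<close>

lemma extend_outside_D:
  assumes "subspace K A V" "vdim A \<le> 1"
  obtains w where "w \<in> carrier V" "w \<notin> A" "\<not> subspace_sum A (span {w}) \<subseteq> D"
    "subspace K (subspace_sum A (span {w})) V" "A \<subseteq> subspace_sum A (span {w})"
    "w \<in> subspace_sum A (span {w})" "vdim (subspace_sum A (span {w})) = Suc (vdim A)"
proof -
  have "A \<noteq> carrier V"
    using assms dim_mono[OF fin D(1) carrier_is_subspace] D(2) subspace_carrier[OF D(1)] by auto
  \<comment> \<open>If \<open>A\<close> lies in the proper subspace \<open>D\<close>, a vector
    outside \<open>D\<close> is chosen, which is also outside \<open>A\<close>. Otherwise any vector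
    outside \<open>A\<close> will do, because \<open>A\<close> itself already keeps the sum from
    lying in \<open>D\<close>.\<close>
  then obtain w where w: "w \<in> carrier V" "w \<notin> A" "A \<subseteq> D \<Longrightarrow> w \<notin> D"
    using subspace_carrier[OF assms(1)] subspace_carrier[OF D(1)] D_proper by blast
  note W = subspace_span_singleton[OF w(1)]
  note S = sum_is_subspace[OF assms(1) W] and sub = subset_subspace_sum[OF assms(1) W]
  have win: "w \<in> subspace_sum A (span {w})"
    using sub span_self[OF w(1)] by auto
  have "vdim A < vdim (subspace_sum A (span {w}))"
    using dim_strict_mono[OF fin assms(1) S] sub(1) win w(2) by blast
  then have "vdim (subspace_sum A (span {w})) = Suc (vdim A)"
    using dim_sum_span_singleton_le[OF fin assms(1) w(1)] by auto
  moreover have "\<not> subspace_sum A (span {w}) \<subseteq> D"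
    using sub(1) win w(3) by blast
  ultimately show ?thesis
    using that[OF w(1,2) _ S sub(1) win] by blast
qed

lemma q_independent1: "M1.q_independent A \<longleftrightarrow> subspace K A V \<and> vdim A \<le> 2 \<and> A \<noteq> D"
  using D by (auto simp: M1.q_independent_def rank1_def)

lemma q_independent2:
  "M2.q_independent A \<longleftrightarrow> subspace K A V \<and> (vdim A = 0 \<or> vdim A = 1 \<and> A \<noteq> C)"
proof (cases "subspace K A V")
  case True
  have "vdim A > 0" if "\<not> A \<subseteq> C"
    using dim_pos_if_not_subset[OF fin True C(1) that] .
  \<comment> \<open>The line \<open>C\<close> has no subspaces other than zero and itself.\<close>
  moreover have "vdim A = 0 \<or> A = C" if "A \<subseteq> C"
    using subset_dim_ge_imp_eq[OF fin True C(1) that] C(2) by (cases "vdim A") simp_all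
  ultimately show ?thesis
    using True C(2) by (cases "A \<subseteq> C") (auto simp: M2.q_independent_def rank2_def)
qed (simp add: M2.q_independent_def)

text \<open>Independent subspaces of dimension at most 1 are not maximal, by
  \<open>extend_outside_D\<close>; those of dimension 2 are, since no independent subspace has
  larger dimension.\<close>

lemma q_basis1: "M1.q_basis A \<longleftrightarrow> subspace K A V \<and> vdim A = 2 \<and> A \<noteq> D"
proof
  assume A: "M1.q_basis A"
  show "subspace K A V \<and> vdim A = 2 \<and> A \<noteq> D"
  proof (rule ccontr)
    assume "\<not> ?thesis"
    then have "subspace K A V" "vdim A \<le> 1"
      using A by (auto simp: M1.q_basis_def q_independent1)
    then obtain w where "w \<notin> A" "\<not> subspace_sum A (span {w}) \<subseteq> D"
      "subspace K (subspace_sum A (span {w})) V" "A \<subseteq> subspace_sum A (span {w})"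
      "w \<in> subspace_sum A (span {w})" "vdim (subspace_sum A (span {w})) = Suc (vdim A)"
      by (rule extend_outside_D)
    moreover from this have "M1.q_independent (subspace_sum A (span {w}))"
      using \<open>vdim A \<le> 1\<close> by (auto simp: q_independent1)
    ultimately show False
      using A by (auto simp: M1.q_basis_def)
  qed
next
  assume A: "subspace K A V \<and> vdim A = 2 \<and> A \<noteq> D"
  have "B = A" if "M1.q_independent B" "A \<subseteq> B" for B
    using that A subset_dim_ge_imp_eq[OF fin, of A B] by (auto simp: q_independent1)
  with A show "M1.q_basis A"
    by (auto simp: M1.q_basis_def q_independent1)
qed

lemma q_basis2: "M2.q_basis A \<longleftrightarrow> subspace K A V \<and> vdim A = 1 \<and> A \<noteq> C"
proof
  assume A: "M2.q_basis A"
  show "subspace K A V \<and> vdim A = 1 \<and> A \<noteq> C"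
  proof (rule ccontr)
    assume "\<not> ?thesis"
    then have A0: "subspace K A V" "vdim A = 0"
      using A by (auto simp: M2.q_basis_def q_independent2)
    from A0(2) have "vdim A \<le> 1"
      by simp
    with A0(1) obtain w where "w \<notin> A" "\<not> subspace_sum A (span {w}) \<subseteq> D"
      "subspace K (subspace_sum A (span {w})) V" "A \<subseteq> subspace_sum A (span {w})"
      "w \<in> subspace_sum A (span {w})" "vdim (subspace_sum A (span {w})) = Suc (vdim A)"
      by (rule extend_outside_D)
    \<comment> \<open>The extension is not inside \<open>D\<close>, hence differs from
      \<open>C\<close>.\<close>
    moreover from this have "M2.q_independent (subspace_sum A (span {w}))"
      using A0(2) CD by (auto simp: q_independent2)
    ultimately show False
      using A by (auto simp: M2.q_basis_def)
  qed
next
  assume A: "subspace K A V \<and> vdim A = 1 \<and> A \<noteq> C"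
  have "B = A" if "M2.q_independent B" "A \<subseteq> B" for B
    using that A subset_dim_ge_imp_eq[OF fin, of A B] by (auto simp: q_independent2)
  with A show "M2.q_basis A"
    by (auto simp: M2.q_basis_def q_independent2)
qed

lemma basis2_extends:
  assumes "M2.q_basis B"
  shows "\<exists>P. M1.q_basis P \<and> B \<subseteq> P"
proof -
  have B: "subspace K B V" "vdim B = 1"
    using assms by (simp_all add: q_basis2)
  then have "vdim B \<le> 1"
    by simp
  with B(1) obtain w where "\<not> subspace_sum B (span {w}) \<subseteq> D"
    "subspace K (subspace_sum B (span {w})) V" "B \<subseteq> subspace_sum B (span {w})"
    "vdim (subspace_sum B (span {w})) = Suc (vdim B)"
    by (rule extend_outside_D)
  with B(2) show ?thesis
    by (intro exI[of _ "subspace_sum B (span {w})"]) (auto simp: q_basis1)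
qed

lemma basis1_contains:
  assumes "M1.q_basis P"
  shows "\<exists>B. M2.q_basis B \<and> B \<subseteq> P"
proof -
  have P: "subspace K P V" "vdim P = 2"
    using assms by (auto simp: q_basis1)
  \<comment> \<open>A plane does not fit into the line \<open>C\<close>; any vector of
    \<open>P\<close> outside \<open>C\<close> spans a basis of \<open>M2\<close>.\<close>
  have "\<not> P \<subseteq> C"
    using dim_mono[OF fin P(1) C(1)] C(2) P(2) by auto
  then obtain w where w: "w \<in> P" "w \<notin> C" "w \<in> carrier V"
    using subspace_carrier[OF P(1)] by blast
  then have "M2.q_basis (span {w})"
    using dim_span_singleton[OF fin C(1) w(3,2)] span_self[OF w(3)] subspace_span_singleton
    by (auto simp: q_basis2)
  then show ?thesis
    using span_singleton_subset[OF P(1) w(1)] by blast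
qed

section \<open>The family between the bases is a weak
  \<open>q\<close>-\<open>g\<close>-matroid\<close>

definition family :: "'c set set" where
  "family = {F. subspace K F V \<and> (vdim F = 1 \<and> F \<noteq> C \<or> vdim F = 2 \<and> F \<noteq> D)}"

lemma family_eq:
  "family = {F. subspace K F V \<and> (\<exists>B2 B1. M2.q_basis B2 \<and> M1.q_basis B1 \<and> B2 \<subseteq> F \<and> F \<subseteq> B1)}"
proof (intro equalityI subsetI)
  fix F assume "F \<in> family"
  then have "subspace K F V \<and> (M2.q_basis F \<or> M1.q_basis F)"
    by (auto simp: family_def q_basis1 q_basis2)
  then show "F \<in> {F. subspace K F V \<and> (\<exists>B2 B1. M2.q_basis B2 \<and> M1.q_basis B1 \<and> B2 \<subseteq> F \<and> F \<subseteq> B1)}"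
    \<comment> \<open>\<open>F\<close> itself serves as one of the two bases; the other comes from
      extending it or from finding a line inside it.\<close>
    using basis2_extends[of F] basis1_contains[of F] by blast
next
  fix F assume "F \<in> {F. subspace K F V \<and> (\<exists>B2 B1. M2.q_basis B2 \<and> M1.q_basis B1 \<and> B2 \<subseteq> F \<and> F \<subseteq> B1)}"
  then obtain B1 B2 where F: "subspace K F V" and B: "M2.q_basis B2" "M1.q_basis B1" "B2 \<subseteq> F" "F \<subseteq> B1"
    by blast
  then have d: "subspace K B2 V" "vdim B2 = 1" "subspace K B1 V" "vdim B1 = 2"
    by (auto simp: q_basis1 q_basis2)
  \<comment> \<open>The dimensions 1 and 2 leave no room strictly between \<open>B2\<close> and
    \<open>B1\<close>.\<close>
  have "F = B2 \<or> F = B1"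
  proof (rule ccontr)
    assume "\<not> ?thesis"
    then have "B2 \<subset> F" "F \<subset> B1"
      using B(3,4) by auto
    then show False
      using dim_strict_mono[OF fin d(1) F] dim_strict_mono[OF fin F d(3)] d(2,4) by linarith
  qed
  with B F show "F \<in> family"
    by (auto simp: family_def q_basis1 q_basis2)
qed

lemma weak_q_g_matroid_family: "weak_q_g_matroid K V family"
  unfolding weak_q_g_matroid_def
  using family_eq basis2_extends basis1_contains q_matroid_rank1 q_matroid_rank2 by blast

section \<open>No strong map yields this family\<close>

lemma not_q_g_matroid_family: "\<not> q_g_matroid K V family"
proof
  assume "q_g_matroid K V family"
  then obtain r1 r2 where "q_matroid K V r1" "q_matroid K V r2" and strong: "id_strong_map K V r1 r2"
    and family: "family = {F. q_matroid.q_independent K V r1 F \<and> q_matroid.q_spanning K V r2 F}"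
    unfolding q_g_matroid_def by blast
  interpret N1: q_matroid K V r1 by fact
  interpret N2: q_matroid K V r2 by fact
  have familyD: "r1 F = int (vdim F)" "r2 F = r2 (carrier V)" if "F \<in> family" for F
    using that by (auto simp: family N1.q_independent_def N2.q_spanning_def)
  have familyI: "F \<in> family" if "subspace K F V" "r1 F = int (vdim F)" "r2 F = r2 (carrier V)" for F
    using that by (auto simp: family N1.q_independent_def N2.q_spanning_def)
  \<comment> \<open>The plane \<open>C + span {w}\<close> differs from \<open>D\<close>, so it is in
    the family and has \<open>r1\<close>-rank 2. By submodularity this rank is at most
    \<open>r1 C + r1 (span {w})\<close>, and both summands are at most 1.\<close>
  have r1_C: "r1 C = 1"
  proof -
    obtain w where w: "w \<in> carrier V" and P: "\<not> subspace_sum C (span {w}) \<subseteq> D"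
      "subspace K (subspace_sum C (span {w})) V" "vdim (subspace_sum C (span {w})) = Suc (vdim C)"
      using C(1) eq_imp_le[OF C(2)] by (rule extend_outside_D)
    note W = subspace_span_singleton[OF w]
    have "subspace_sum C (span {w}) \<in> family"
      using P C by (auto simp: family_def)
    then have "r1 (subspace_sum C (span {w})) = 2"
      using familyD P C by auto
    moreover have "r1 (span {w}) \<le> 1"
      using N1.rank_bounds[OF W] dim_span_singleton_le[OF w] by linarith
    ultimately show ?thesis
      using N1.rank_submodular[OF C(1) W] N1.rank_bounds[OF C(1)]
        N1.rank_bounds[OF subspace_Int[OF C(1) W]] C(2) by linarith
  qed
  have "C \<notin> family"
    using C by (auto simp: family_def)
  then have "r2 C \<noteq> r2 (carrier V)"
    using familyI[OF C(1)] r1_C C(2) by auto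
  then have r2_C: "r2 C < r2 (carrier V)"
    using N2.rank_mono[OF C(1) carrier_is_subspace subspace_carrier[OF C(1)]] by simp
  have line: "r2 X = r2 (carrier V)" if "subspace K X V" "vdim X = 1" "\<not> X \<subseteq> C" for X
    using that familyD(2)[of X] by (auto simp: family_def)
  have "N2.q_flat C"
    unfolding N2.q_flat_def
  proof (intro conjI allI impI C(1))
    fix X assume X: "subspace K X V \<and> vdim X = 1 \<and> \<not> X \<subseteq> C"
    \<comment> \<open>Adding a line \<open>X\<close> other than \<open>C\<close> brings the rank up
      to that of the whole space, since \<open>X\<close> is already spanning.\<close>
    then have "r2 X \<le> r2 (subspace_sum C X)"
      using N2.rank_mono sum_is_subspace[OF C(1)] subset_subspace_sum(2)[OF C(1)] by blast
    then show "r2 (subspace_sum C X) > r2 C"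
      using line[of X] X r2_C by linarith
  qed
  then have flat: "N1.q_flat C"
    using strong by (auto simp: id_strong_map_def)
  \<comment> \<open>Such a vector exists because \<open>C\<close> and \<open>D\<close> have
    different dimensions. Flatness of \<open>C\<close> is applied to the line it spans, which stays
    inside \<open>D\<close>.\<close>
  obtain d where d: "d \<in> D" "d \<notin> C"
    using C D CD by (metis One_nat_def numeral_eq_one_iff semiring_norm(85) subsetI subset_antisym)
  then have dV: "d \<in> carrier V"
    using subspace_carrier[OF D(1)] by blast
  note X = subspace_span_singleton[OF dV]
  have X1: "vdim (span {d}) = 1" "\<not> span {d} \<subseteq> C" "span {d} \<subseteq> D"
    using dim_span_singleton[OF fin C(1) dV d(2)] span_self[OF dV] d span_singleton_subset[OF D(1)]
    by auto
  have "1 < r1 (subspace_sum C (span {d}))"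
    using flat X X1 r1_C by (auto simp: N1.q_flat_def)
  also have "\<dots> \<le> r1 D"
    using N1.rank_mono[OF sum_is_subspace[OF C(1) X] D(1)] vsum_is_minimal[OF C(1) X D(1)] CD X1
    by auto
  finally have "r1 D = int (vdim D)"
    using N1.rank_bounds[OF D(1)] D(2) by auto
  \<comment> \<open>\<open>D\<close> contains the line \<open>span {d}\<close>, which is spanning in
    \<open>N2\<close>.\<close>
  moreover have "r2 D = r2 (carrier V)"
    using line[OF X X1(1,2)] N2.rank_mono[OF X D(1) X1(3)]
      N2.rank_mono[OF D(1) carrier_is_subspace subspace_carrier[OF D(1)]] by simp
  ultimately have "D \<in> family"
    using familyI[OF D(1)] by blast
  then show False
    using D by (auto simp: family_def)
qed

end

section \<open>A line in a proper plane of a coordinate space\<close>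

context field
begin

lemma vectorspace_coordinate_space: "vectorspace R (func_space S)"
  by (simp add: vectorspace_def func_space_is_module field_axioms)

text \<open>These coordinate hyperplanes serve to separate unit vectors from spans of other unit
  vectors.\<close>

lemma subspace_vanishing:
  assumes "i \<in> S"
  shows "subspace R {f \<in> carrier (func_space S). f i = \<zero>} (func_space S)"
  using assms vectorspace_coordinate_space[of S] func_space_is_module[of S]
  by (auto simp: subspace_def submodule_def func_space_def)

definition unit_function :: "'i set \<Rightarrow> 'i \<Rightarrow> 'i \<Rightarrow> 'a" where
  "unit_function S i = (\<lambda>j\<in>S. if j = i then \<one> else \<zero>)"

text \<open>Over a finite field the space has finitely many vectors, so its whole carrier is a
  finite generating set.\<close>

lemma fin_dim_func_space:
  assumes "finite (carrier R)" "finite S"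
  shows "vectorspace.fin_dim R (func_space S)"
proof -
  interpret vectorspace R "func_space S"
    by (rule vectorspace_coordinate_space)
  have "finite (carrier (func_space S))"
    using assms by (auto simp: func_space_def intro: finite_PiE)
  moreover have "gen_set (carrier (func_space S))"
    using in_own_span span_is_subset2 by blast
  ultimately show ?thesis
    unfolding fin_dim_def by blast
qed

lemma point_on_line_coordinate_space:
  assumes "finite (carrier R)" "n \<ge> 3"
  shows "\<exists>C D. point_on_line R (coordinate_space R n) C D"
proof -
  let ?V = "coordinate_space R n"
  interpret V: vectorspace R ?V
    by (rule vectorspace_coordinate_space)
  have fin: "V.fin_dim"
    using fin_dim_func_space assms by blast
  define e where "e = unit_function {..<n}"
  define H where "H i = {f \<in> carrier ?V. f i = \<zero>}" for i
  have e: "e i \<in> carrier ?V" for i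
    by (auto simp: e_def unit_function_def func_space_def)
  have H: "subspace R (H i) ?V" if "i < n" for i
    using that subspace_vanishing[of i "{..<n}"] by (simp add: H_def)
  have eH: "e i \<in> H j \<longleftrightarrow> i \<noteq> j" if "j < n" for i j
    using that e[of i] by (auto simp: H_def e_def unit_function_def)
  define C where "C = V.span {e 0}"
  define D where "D = V.subspace_sum C (V.span {e 1})"
  have C: "subspace R C ?V" "V.vdim C = 1"
    using V.dim_span_singleton[OF fin H[of 0] e[of 0]] V.subspace_span_singleton[OF e] eH assms
    by (auto simp: C_def)
  note E1 = V.subspace_span_singleton[OF e[of 1]]
  have D: "subspace R D ?V" "C \<subseteq> D" "e 1 \<in> D"
    using V.sum_is_subspace[OF C(1) E1] V.subset_subspace_sum[OF C(1) E1] V.span_self[OF e[of 1]]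
    by (auto simp: D_def)
  \<comment> \<open>\<open>H 1\<close> contains \<open>C\<close> but not \<open>e 1\<close>, so
    \<open>D\<close> is strictly larger than \<open>C\<close>; adding one vector raises the
    dimension by at most one.\<close>
  have "C \<subseteq> H 1"
    unfolding C_def using V.span_singleton_subset[OF H] eH assms by auto
  then have "C \<subset> D"
    using D eH[of 1 1] assms by auto
  then have D2: "V.vdim D = 2"
    using V.dim_strict_mono[OF fin C(1) D(1)] V.dim_sum_span_singleton_le[OF fin C(1) e[of 1]] C(2)
    by (auto simp: D_def)
  \<comment> \<open>\<open>H 2\<close> contains \<open>D\<close> but not \<open>e 2\<close>, so
    \<open>D\<close> is proper; this third unit vector is where \<open>n \<ge> 3\<close> is
    used.\<close>
  have "D \<subseteq> H 2"
    unfolding D_def C_def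
    using V.vsum_is_minimal[OF C(1) E1 H[of 2]] V.span_singleton_subset[OF H[of 2]] eH[of 2] assms
    by (auto simp: C_def)
  then have "D \<noteq> carrier ?V"
    using e[of 2] eH[of 2 2] assms by auto
  then have "point_on_line R ?V C D"
    using V.vectorspace_axioms fin C D D2 by (simp add: point_on_line_def point_on_line_axioms_def)
  then show ?thesis
    by blast
qed

end

theorem proposition4p6:
  shows "\<exists>(K :: int ring) (n :: nat) (\<F> :: (nat \<Rightarrow> int) set set).
    field K \<and> finite (carrier K) \<and>
    (\<forall>F\<in>\<F>. subspace K F (coordinate_space K n)) \<and>
    weak_q_g_matroid K (coordinate_space K n) \<F> \<and>
    \<not> q_g_matroid K (coordinate_space K n) \<F>"
proof -
  \<comment> \<open>The witness is the three-dimensional space over the field with two elements; by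
    \<open>point_on_line_coordinate_space\<close> any finite field and any \<open>n \<ge> 3\<close>
    supply such \<open>C\<close> and \<open>D\<close>.\<close>
  interpret residues_prime 2 "residue_ring 2"
    by unfold_locales (auto simp: two_is_prime_nat)
  obtain C D where "point_on_line (residue_ring 2) (coordinate_space (residue_ring 2) 3) C D"
    using point_on_line_coordinate_space[of 3] finite by auto
  then interpret point_on_line "residue_ring 2" "coordinate_space (residue_ring 2) 3" C D .
  have "\<forall>F\<in>family. subspace (residue_ring 2) F (coordinate_space (residue_ring 2) 3)"
    by (simp add: family_def)
  then show ?thesis
    using is_field finite weak_q_g_matroid_family not_q_g_matroid_family by blast
qed

end
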